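(* Let $C \in \mathrm{CGA}_+[t]$ be a monic spinor polynomial and let $M := (t-z_1)(t-z_2) \in \mathbb{R}[t]$, with $z_1, z_2 \in \mathbb{C}$, be a monic, quadratic factor of $C\widetilde{C}$. Suppose that $a_1$ and $a_2$ are points (possibly with complex coordinates) that are non-orthogonal, i.e. $a_1 \cdot a_2 \neq 0$, and that are left annihilators of $C(z_1)$ and $C(z_2)$, respectively, i.e. $a_1 C(z_1) = 0$ and $a_2 C(z_2) = 0$. Then $C$ has the left factor $t-h$, where $$h := z_1 - \frac{z_1-z_2}{2\,a_1\cdot a_2}\,a_1 a_2 = \frac{z_1+z_2}{2} - \frac{z_1-z_2}{2\,a_1\cdot a_2}\,a_1\wedge a_2,$$ and $(t-h)(t-\widetilde{h}) = M$.
   Context: $\mathrm{CGA}$ is the real Clifford algebra $\mathcal{C}\ell(4,1)$ generated by anti-commuting elements $e_1,e_2,e_3,e_+,e_-$ with $e_1^2=e_2^2=e_3^2=e_+^2=1$, $e_-^2=-1$. Its even sub-algebra is $\mathrm{CGA}_+$. Throughout, scalar extension to $\mathbb{C}$ is allowed: elements of $\mathrm{CGA}$ and $\mathrm{CGA}_+$ may have complex coefficients when needed. The reverse $\widetilde{q}$ is the linear anti-automorphism (complex-linear on the complexification) reversing the order of products of the generators. Vectors are grade one elements, i.e. linear combinations of $e_1,e_2,e_3,e_+,e_-$. For vectors $a,b$ put $a\cdot b = \tfrac12(ab+ba)$ (a scalar) and $a\wedge b=\tfrac12(ab-ba)$. A point is a nonzero vector $a$ with $a^2=0$. In $\mathrm{CGA}_+[t]$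 the indeterminate $t$ commutes with all coefficients; polynomials in $\mathrm{CGA}_+[t]$ may be evaluated at complex numbers $z$, giving values in $\mathrm{CGA}_+\otimes\mathbb{C}$. For $C=\sum t^i q_i$ put $\widetilde{C}=\sum t^i\widetilde{q}_i$. A polynomial $C$ (with real $\mathrm{CGA}_+$ coefficients) is a spinor polynomial if $C\widetilde{C}=\widetilde{C}C\in\mathbb{R}[t]\setminus\{0\}$. A polynomial $t-h$ is a left factor of $C$ if $C=(t-h)Q$ for some polynomial $Q$, where for $h$ with complex coefficients, $Q$ is allowed to have coefficients in $\mathrm{CGA}_+\otimes\mathbb{C}$. *)

theory Defs
  imports Complex_Main "HOL-Library.Poly_Mapping"
begin

section \<open>The Clifford algebra with signature (4,1)\<close>

datatype cga_gen = E1 | E2 | E3 | EP | EM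

lemma UNIV_cga_gen: "(UNIV :: cga_gen set) = {E1, E2, E3, EP, EM}"
  using cga_gen.exhaust by auto

instance cga_gen :: finite
  by standard (simp add: UNIV_cga_gen)

primrec gen_index :: "cga_gen \<Rightarrow> nat" where
  "gen_index E1 = 0"
| "gen_index E2 = 1"
| "gen_index E3 = 2"
| "gen_index EP = 3"
| "gen_index EM = 4"

lemma gen_index_eq_iff [simp]: "gen_index i = gen_index j \<longleftrightarrow> i = j"
  by (cases i; cases j) simp_all

primrec gen_square :: "cga_gen \<Rightarrow> int" where
  "gen_square E1 = 1"
| "gen_square E2 = 1"
| "gen_square E3 = 1"
| "gen_square EP = 1"
| "gen_square EM = -1"

lemma gen_square_mult_self [simp]: "gen_square i * gen_square i = 1"
  by (cases i) simp_all

text \<open>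
  A multivector is given by its coordinates in the basis of blades \<open>e\<^sub>A\<close>, where
  \<open>e\<^sub>A\<close> is the product, in the order \<open>E1, E2, E3, EP, EM\<close>, of the generators in the set \<open>A\<close>.
  The scalars \<^typ>\<open>'a\<close> are left open: \<open>real cga\<close> is the real algebra and
  \<open>complex cga\<close> its complexification.
\<close>

typedef 'a cga = "UNIV :: (cga_gen set \<Rightarrow> 'a) set"
  morphisms coord Multivector by simp

lemma coord_Multivector [simp]: "coord (Multivector f) = f"
  by (simp add: Multivector_inverse)

lemma cga_eqI: "(\<And>S. coord x S = coord y S) \<Longrightarrow> x = y"
  by (metis coord_inject ext)

text \<open>
  Sorting the product \<open>e\<^sub>A e\<^sub>B\<close> costs a sign for every pair of generators that is
  out of order, and every generator common to \<open>A\<close> and \<open>B\<close> contributes its square.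
  Hence \<open>e\<^sub>A e\<^sub>B = blade_sign A B e\<^sub>C\<close> where \<open>C\<close> is the symmetric difference of \<open>A\<close> and \<open>B\<close>.
\<close>

definition gen_sign :: "cga_gen \<Rightarrow> cga_gen \<Rightarrow> int" where
  "gen_sign i j =
    (if i = j then gen_square i else if gen_index j < gen_index i then -1 else 1)"

definition blade_sign :: "cga_gen set \<Rightarrow> cga_gen set \<Rightarrow> int" where
  "blade_sign A B = (\<Prod>i\<in>A. \<Prod>j\<in>B. gen_sign i j)"

lemma gen_sign_mult_self [simp]: "gen_sign i j * gen_sign i j = 1"
  by (simp add: gen_sign_def)

lemma prod_sym_diff:
  fixes f :: "cga_gen \<Rightarrow> int"
  assumes "\<And>i. f i * f i = 1"
  shows "prod f (sym_diff A B) = prod f A * prod f B"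
proof -
  have "prod f A = prod f (A - B) * prod f (A \<inter> B)"
    using prod.Int_Diff [of A f B] by (simp add: mult.commute)
  moreover have "prod f B = prod f (B - A) * prod f (A \<inter> B)"
    using prod.Int_Diff [of B f A] by (simp add: mult.commute Int_commute)
  moreover have "prod f (A \<inter> B) * prod f (A \<inter> B) = 1"
    by (simp add: prod.distrib [symmetric] assms)
  moreover have "prod f (sym_diff A B) = prod f (A - B) * prod f (B - A)"
    by (rule prod.union_disjoint) auto
  ultimately show ?thesis
    by (simp add: ac_simps)
qed

lemma blade_sign_sym_diff_left:
  "blade_sign (sym_diff A B) C = blade_sign A C * blade_sign B C"
  unfolding blade_sign_def
  by (rule prod_sym_diff) (simp add: prod.distrib [symmetric])

lemma blade_sign_sym_diff_right:
  "blade_sign A (sym_diff B C) = blade_sign A B * blade_sign A C"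
proof -
  have "blade_sign A (sym_diff B C) = (\<Prod>i\<in>A. prod (gen_sign i) B * prod (gen_sign i) C)"
    unfolding blade_sign_def by (rule prod.cong) (simp_all add: prod_sym_diff)
  then show ?thesis
    by (simp add: prod.distrib blade_sign_def)
qed

lemma blade_sign_empty [simp]: "blade_sign {} B = 1" "blade_sign A {} = 1"
  by (simp_all add: blade_sign_def)

instantiation cga :: (zero) zero
begin
definition zero_cga_def: "0 = Multivector (\<lambda>S. 0)"
instance ..
end

instantiation cga :: (comm_ring_1) ring_1
begin

definition one_cga_def: "1 = Multivector (\<lambda>S. if S = {} then 1 else 0)"

definition plus_cga_def: "x + y = Multivector (\<lambda>S. coord x S + coord y S)"

definition minus_cga_def: "x - y = Multivector (\<lambda>S. coord x S - coord y S)"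

definition uminus_cga_def: "- x = Multivector (\<lambda>S. - coord x S)"

definition times_cga_def:
  "x * y = Multivector (\<lambda>S. \<Sum>A\<in>UNIV.
     of_int (blade_sign A (sym_diff A S)) * coord x A * coord y (sym_diff A S))"

instance
proof
  fix x y z :: "'a cga"
  let ?c = "\<lambda>A B. (of_int (blade_sign A B) :: 'a)"
  have bij: "bij (\<lambda>A :: cga_gen set. sym_diff B A)" for B
    by (rule o_bij [where g = "\<lambda>A. sym_diff B A"]) (auto simp: fun_eq_iff)
  have sd: "sym_diff (sym_diff B A) S = sym_diff A (sym_diff B S)" 
    "sym_diff B (sym_diff B A) = A" for A B S :: "cga_gen set" by auto
  show "x * y * z = x * (y * z)"
  proof (rule cga_eqI)
    fix S
    have "coord (x * y * z) S =
      (\<Sum>A\<in>UNIV. \<Sum>B\<in>UNIV. ?c A (sym_diff A S) * (?c B (sym_diff B A) * coord x B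
         * coord y (sym_diff B A)) * coord z (sym_diff A S))"
      by (simp add: times_cga_def sum_distrib_left sum_distrib_right)
    also have "\<dots> = (\<Sum>B\<in>UNIV. \<Sum>A\<in>UNIV. ?c A (sym_diff A S) * (?c B (sym_diff B A) * coord x B
         * coord y (sym_diff B A)) * coord z (sym_diff A S))"
      by (rule sum.swap)
    also have "\<dots> = (\<Sum>B\<in>UNIV. \<Sum>A\<in>UNIV. ?c (sym_diff B A) (sym_diff A (sym_diff B S)) * (?c B A * coord x B
         * coord y A) * coord z (sym_diff A (sym_diff B S)))"
    proof (rule sum.cong [OF refl])
      fix B :: "cga_gen set"
      show "(\<Sum>A\<in>UNIV. ?c A (sym_diff A S) * (?c B (sym_diff B A) * coord x B
         * coord y (sym_diff B A)) * coord z (sym_diff A S)) =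
        (\<Sum>A\<in>UNIV. ?c (sym_diff B A) (sym_diff A (sym_diff B S)) * (?c B A * coord x B
         * coord y A) * coord z (sym_diff A (sym_diff B S)))"
        by (rule trans [OF sum.reindex_bij_betw [OF bij [of B], symmetric]]) (simp only: sd)
    qed
    also have "\<dots> = (\<Sum>B\<in>UNIV. \<Sum>A\<in>UNIV. ?c B (sym_diff B S) * coord x B *
        (?c A (sym_diff A (sym_diff B S)) * coord y A * coord z (sym_diff A (sym_diff B S))))"
    proof (intro sum.cong refl)
      fix A B :: "cga_gen set"
      have "blade_sign (sym_diff B A) (sym_diff A (sym_diff B S)) * blade_sign B A
          = blade_sign A (sym_diff A (sym_diff B S)) * 
            (blade_sign B (sym_diff A (sym_diff B S)) * blade_sign B A)"
        by (simp only: blade_sign_sym_diff_left mult_ac)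
      also have "blade_sign B (sym_diff A (sym_diff B S)) * blade_sign B A
          = blade_sign B (sym_diff (sym_diff A (sym_diff B S)) A)"
        by (simp only: blade_sign_sym_diff_right)
      also have "sym_diff (sym_diff A (sym_diff B S)) A = sym_diff B S"
        by auto
      finally have eq: "?c (sym_diff B A) (sym_diff A (sym_diff B S)) * ?c B A
          = ?c A (sym_diff A (sym_diff B S)) * ?c B (sym_diff B S)"
        by (metis of_int_mult)
      have "?c (sym_diff B A) (sym_diff A (sym_diff B S)) * (?c B A * coord x B
         * coord y A) * coord z (sym_diff A (sym_diff B S)) =
        (?c (sym_diff B A) (sym_diff A (sym_diff B S)) * ?c B A) *
          (coord x B * coord y A * coord z (sym_diff A (sym_diff B S)))"
        by (simp only: mult_ac)
      then show "?c (sym_diff B A) (sym_diff A (sym_diff B S)) * (?c B A * coord x B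
         * coord y A) * coord z (sym_diff A (sym_diff B S)) = ?c B (sym_diff B S) * coord x B *
        (?c A (sym_diff A (sym_diff B S)) * coord y A * coord z (sym_diff A (sym_diff B S)))"
        unfolding eq by (simp only: mult_ac)
    qed
    also have "\<dots> = coord (x * (y * z)) S"
      by (simp add: times_cga_def sum_distrib_left)
    finally show "coord (x * y * z) S = coord (x * (y * z)) S" .
  qed
  show "1 * x = x"
    by (rule cga_eqI) (simp add: times_cga_def one_cga_def if_distrib if_distribR sum.delta cong: if_cong)
  show "x * 1 = x"
  proof (rule cga_eqI)
    fix S
    have "coord (x * 1) S = (\<Sum>A\<in>UNIV. if A = S then coord x A else 0)"
      unfolding times_cga_def one_cga_def coord_Multivector
      by (rule sum.cong) auto
    then show "coord (x * 1) S = coord x S" by simp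
  qed
  have "coord (0 :: 'a cga) {} \<noteq> coord 1 {}"
    by (simp add: zero_cga_def one_cga_def)
  then show "(0 :: 'a cga) \<noteq> 1" by metis
qed (auto intro!: cga_eqI simp: zero_cga_def plus_cga_def minus_cga_def uminus_cga_def
    times_cga_def algebra_simps sum.distrib)

end

lemma coord_simps [simp]:
  "coord 0 S = (0 :: 'b :: zero)"
  "coord 1 S = (if S = {} then 1 else 0 :: 'a :: comm_ring_1)"
  "coord (x + y) S = (coord x S + coord y S :: 'a)"
  "coord (x - y) S = (coord x S - coord y S :: 'a)"
  "coord (- x) S = (- coord x S :: 'a)"
  by (simp_all add: zero_cga_def one_cga_def plus_cga_def minus_cga_def uminus_cga_def)

lemma coord_mult:
  "coord (x * y) S =
    (\<Sum>A\<in>UNIV. of_int (blade_sign A (sym_diff A S)) * coord x A * coord y (sym_diff A S))"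
  by (simp add: times_cga_def)

lemma coord_sum [simp]: "coord (sum f I) S = (\<Sum>i\<in>I. coord (f i) S)"
  by (induction I rule: infinite_finite_induct) simp_all


subsection \<open>Scalars and generators\<close>

definition scale :: "'a :: comm_ring_1 \<Rightarrow> 'a cga \<Rightarrow> 'a cga" where
  "scale c x = Multivector (\<lambda>S. c * coord x S)"

definition scalar :: "'a :: comm_ring_1 \<Rightarrow> 'a cga" where
  "scalar c = scale c 1"

definition blade :: "cga_gen set \<Rightarrow> 'a :: comm_ring_1 cga" where
  "blade A = Multivector (\<lambda>S. if S = A then 1 else 0)"

definition gen :: "cga_gen \<Rightarrow> 'a :: comm_ring_1 cga" where
  "gen i = blade {i}"

lemma coord_scale [simp]: "coord (scale c x) S = c * coord x S"
  by (simp add: scale_def)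

lemma coord_scalar [simp]: "coord (scalar c) S = (if S = {} then c else 0)"
  by (simp add: scalar_def)

lemma coord_blade [simp]: "coord (blade A) S = (if S = A then 1 else 0)"
  by (simp add: blade_def)

lemma scalar_mult: "scalar c * x = scale c x"
  by (rule cga_eqI) (simp add: coord_mult if_distrib if_distribR cong: if_cong)

lemma mult_scalar: "x * scalar c = scale c x"
proof (rule cga_eqI)
  fix S
  have "coord (x * scalar c) S = (\<Sum>A\<in>UNIV. if A = S then c * coord x A else 0)"
    unfolding coord_mult coord_scalar by (rule sum.cong) auto
  then show "coord (x * scalar c) S = coord (scale c x) S" by simp
qed

lemma blade_mult:
  "blade A * blade B = scale (of_int (blade_sign A B)) (blade (sym_diff A B))"
proof (rule cga_eqI)
  fix S
  have "coord (blade A * blade B :: 'a cga) S =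
      (\<Sum>D\<in>UNIV. if D = A then
         (if sym_diff A S = B then of_int (blade_sign A (sym_diff A S)) else 0) else 0)"
    unfolding coord_mult coord_blade by (rule sum.cong) auto
  also have "\<dots> = (if S = sym_diff A B then of_int (blade_sign A B) else 0)"
    by (auto intro: arg_cong)
  finally show "coord (blade A * blade B :: 'a cga) S =
      coord (scale (of_int (blade_sign A B)) (blade (sym_diff A B))) S"
    by simp
qed

lemma gen_mult_self: "gen i * gen i = scalar (of_int (gen_square i))"
  by (rule cga_eqI) (simp add: gen_def blade_mult blade_sign_def gen_sign_def)

lemma gen_anticommute: "i \<noteq> j \<Longrightarrow> gen i * gen j = - (gen j * gen i)"
proof (rule cga_eqI)
  fix S assume ij: "i \<noteq> j"
  then have "gen_index i < gen_index j \<or> gen_index j < gen_index i"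
    by (meson gen_index_eq_iff linorder_neqE_nat)
  moreover have "sym_diff {i} {j} = {i, j}" "sym_diff {j} {i} = {i, j}" 
    using ij by auto
  ultimately show "coord (gen i * gen j) S = coord (- (gen j * gen i)) S"
    using ij
    by (auto simp: gen_def blade_mult blade_sign_def gen_sign_def)
qed

lemma blade_empty: "blade {} = 1"
  by (rule cga_eqI) (simp add: blade_def)

lemma blade_insert:
  assumes "\<And>j. j \<in> A \<Longrightarrow> gen_index i < gen_index j"
  shows "blade (insert i A) = gen i * blade A"
proof -
  have "i \<notin> A" using assms by blast
  then have "sym_diff {i} A = insert i A" by auto
  moreover have "blade_sign {i} A = 1"
    unfolding blade_sign_def using assms by (fastforce simp: gen_sign_def intro!: prod.neutral)
  ultimately show ?thesis
    by (intro cga_eqI) (simp add: gen_def blade_mult)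
qed

lemma blade_expansion: "x = (\<Sum>A\<in>UNIV. scale (coord x A) (blade A))"
  by (rule cga_eqI) (simp add: if_distrib cong: if_cong)


subsection \<open>Even subalgebra, reversion, vectors\<close>

definition cga_even :: "'a :: zero cga set" where
  "cga_even = {x. \<forall>S. odd (card S) \<longrightarrow> coord x S = 0}"

text \<open>
  Reversing a product of \<open>k\<close> distinct anticommuting generators takes
  \<open>k choose 2\<close> transpositions. The lemmas \<open>reverse_gen\<close>, \<open>reverse_scalar\<close>, \<open>reverse_add\<close> and
  \<open>reverse_mult\<close> characterise this map.
\<close>

definition reverse :: "'a :: comm_ring_1 cga \<Rightarrow> 'a cga" where
  "reverse x = Multivector (\<lambda>S. (-1) ^ (card S choose 2) * coord x S)"

lemma coord_reverse [simp]: "coord (reverse x) S = (-1) ^ (card S choose 2) * coord x S"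
  by (simp add: reverse_def)

lemma reverse_gen: "reverse (gen i) = gen i"
  by (rule cga_eqI) (simp add: gen_def numeral_2_eq_2)

lemma reverse_scalar: "reverse (scalar c) = scalar c"
  by (rule cga_eqI) (simp add: numeral_2_eq_2)

lemma reverse_add: "reverse (x + y) = reverse x + reverse y"
  by (rule cga_eqI) (simp add: algebra_simps)

lemma reverse_scale: "reverse (scale c x) = scale c (reverse x)"
  by (rule cga_eqI) (simp add: algebra_simps)

lemma gen_sign_swap: "gen_sign i j = (if i = j then 1 else -1) * gen_sign j i"
  using gen_index_eq_iff [of i j] by (auto simp: gen_sign_def)

lemma minus_one_power_eqI: "even (m + n) \<Longrightarrow> (-1 :: int) ^ m = (-1) ^ n"
  by (metis even_add minus_one_power_iff)

lemma blade_sign_swap: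
  "blade_sign A B = (-1) ^ (card A * card B + card (A \<inter> B)) * blade_sign B A"
proof -
  have "(\<Prod>j\<in>B. if i = j then 1 else - 1 :: int) = (-1) ^ card B * (if i \<in> B then -1 else 1)" for i
  proof (cases "i \<in> B")
    case True
    then have "(\<Prod>j\<in>B. if i = j then 1 else - 1 :: int) = (\<Prod>j\<in>B - {i}. if i = j then 1 else - 1)"
      by (subst prod.remove) auto
    also have "\<dots> = (\<Prod>j\<in>B - {i}. - 1)" by (rule prod.cong) auto
    also have "\<dots> = (-1) ^ (card B - 1)" using True by simp
    finally show ?thesis using True
      by (cases "card B") auto
  next
    case False
    then have "(\<Prod>j\<in>B. if i = j then 1 else - 1 :: int) = (\<Prod>j\<in>B. - 1)"
      by (intro prod.cong) auto
    then show ?thesis using False by simp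
  qed
  then have "(\<Prod>i\<in>A. \<Prod>j\<in>B. if i = j then 1 else - 1 :: int) =
      (-1) ^ (card A * card B) * (\<Prod>i\<in>A. if i \<in> B then -1 else 1)"
    by (simp add: prod.distrib power_mult [symmetric] mult.commute)
  also have "(\<Prod>i\<in>A. if i \<in> B then -1 else 1 :: int) = (\<Prod>i\<in>A \<inter> B. -1)"
    by (rule prod.inter_restrict [symmetric]) simp
  finally have *: "(\<Prod>i\<in>A. \<Prod>j\<in>B. if i = j then 1 else - 1 :: int) =
      (-1) ^ (card A * card B + card (A \<inter> B))"
    by (simp add: power_add)
  have "blade_sign A B = (\<Prod>i\<in>A. \<Prod>j\<in>B. (if i = j then 1 else -1) * gen_sign j i)"
    unfolding blade_sign_def by (intro prod.cong refl gen_sign_swap)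
  also have "\<dots> = (\<Prod>i\<in>A. \<Prod>j\<in>B. if i = j then 1 else -1) * (\<Prod>i\<in>A. \<Prod>j\<in>B. gen_sign j i)"
    by (simp only: prod.distrib)
  also have "(\<Prod>i\<in>A. \<Prod>j\<in>B. gen_sign j i) = blade_sign B A"
    unfolding blade_sign_def by (rule prod.swap)
  finally show ?thesis unfolding * .
qed

lemma card_sym_diff: "card (sym_diff A B) + 2 * card (A \<inter> B) = card A + card B"
  for A B :: "cga_gen set"
proof -
  have "card (sym_diff A B) = card (A - B) + card (B - A)"
    by (rule card_Un_disjoint) auto
  moreover have "card A = card (A - B) + card (A \<inter> B)"
    using card_Un_disjoint [of "A - B" "A \<inter> B"] by (simp add: Un_Diff_Int Int_Diff_disjoint disjoint_iff)
  moreover have "card B = card (B - A) + card (A \<inter> B)"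
    using card_Un_disjoint [of "B - A" "B \<inter> A"] by (simp add: Un_Diff_Int disjoint_iff inf_commute [of A B])
  ultimately show ?thesis by simp
qed

lemma choose_two_add: "(m + n) choose 2 = (m choose 2) + (n choose 2) + m * n"
  by (induction m) (simp_all add: numeral_2_eq_2 algebra_simps)

lemma choose_two_double: "even ((2 * n choose 2) + n)"
proof (induction n)
  case (Suc n)
  have "2 * Suc n choose 2 = (2 * n choose 2) + 1 + 4 * n"
    using choose_two_add [of "2 * n" 2] by simp
  with Suc show ?case by presburger
qed (simp add: numeral_2_eq_2)

lemma reverse_sign:
  "(-1 :: int) ^ (card (sym_diff A B) choose 2) * blade_sign A B =
    (-1) ^ (card A choose 2) * (-1) ^ (card B choose 2) * blade_sign B A"
proof -
  let ?d = "card (sym_diff A B)" and ?c = "card (A \<inter> B)"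
  have "(card A + card B) choose 2 = (?d choose 2) + (2 * ?c choose 2) + ?d * (2 * ?c)"
    by (simp only: card_sym_diff [symmetric] choose_two_add)
  then have "(?d choose 2) + (card A * card B + ?c) + ((card A choose 2) + (card B choose 2)) =
      2 * (?d choose 2) + ((2 * ?c choose 2) + ?c) + 2 * (?d * ?c)"
    using choose_two_add [of "card A" "card B"] by simp
  then have "even ((?d choose 2) + (card A * card B + ?c) + ((card A choose 2) + (card B choose 2)))"
    using choose_two_double [of ?c] by (simp only: dvd_add dvd_triv_left)
  then have "(-1 :: int) ^ ((?d choose 2) + (card A * card B + ?c)) =
      (-1) ^ ((card A choose 2) + (card B choose 2))"
    by (rule minus_one_power_eqI)
  then show ?thesis
    by (subst blade_sign_swap) (simp add: power_add)
qed

lemma reverse_mult: "reverse (x * y) = reverse y * reverse x"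
proof (rule cga_eqI)
  fix S
  let ?c = "\<lambda>A B. (of_int (blade_sign A B) :: 'a)"
  let ?r = "\<lambda>A :: cga_gen set. (-1) ^ (card A choose 2) :: 'a"
  have bij: "bij (\<lambda>A :: cga_gen set. sym_diff A S)"
    by (rule o_bij [where g = "\<lambda>A. sym_diff A S"]) (auto simp: fun_eq_iff)
  have sd: "sym_diff (sym_diff A S) S = A" for A by auto
  have "coord (reverse (x * y)) S =
      (\<Sum>A\<in>UNIV. ?r S * (?c A (sym_diff A S) * coord x A * coord y (sym_diff A S)))"
    by (simp add: coord_mult sum_distrib_left)
  also have "\<dots> = (\<Sum>A\<in>UNIV. ?c (sym_diff A S) A * (?r (sym_diff A S) * coord y (sym_diff A S))
      * (?r A * coord x A))"
  proof (intro sum.cong refl)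
    fix A
    have "sym_diff A (sym_diff A S) = S" by auto
    with reverse_sign [of A "sym_diff A S"] 
    have "(-1 :: int) ^ (card S choose 2) * blade_sign A (sym_diff A S) =
      (-1) ^ (card A choose 2) * (-1) ^ (card (sym_diff A S) choose 2) * blade_sign (sym_diff A S) A"
      by simp
    then have "of_int ((-1) ^ (card S choose 2) * blade_sign A (sym_diff A S)) =
      (of_int ((-1) ^ (card A choose 2) * (-1) ^ (card (sym_diff A S) choose 2)
        * blade_sign (sym_diff A S) A) :: 'a)"
      by (rule arg_cong)
    then have eq: "?r S * ?c A (sym_diff A S) = ?r A * ?r (sym_diff A S) * ?c (sym_diff A S) A"
      by (simp only: of_int_mult of_int_power of_int_minus of_int_1)
    have "?r S * (?c A (sym_diff A S) * coord x A * coord y (sym_diff A S)) =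
      (?r S * ?c A (sym_diff A S)) * (coord x A * coord y (sym_diff A S))"
      by (simp only: mult_ac)
    then show "?r S * (?c A (sym_diff A S) * coord x A * coord y (sym_diff A S)) =
      ?c (sym_diff A S) A * (?r (sym_diff A S) * coord y (sym_diff A S)) * (?r A * coord x A)"
      unfolding eq by (simp only: mult_ac)
  qed
  also have "\<dots> = (\<Sum>B\<in>UNIV. ?c B (sym_diff B S) * (?r B * coord y B)
      * (?r (sym_diff B S) * coord x (sym_diff B S)))"
    by (rule trans [OF sum.reindex_bij_betw [OF bij, symmetric]]) (simp only: sd)
  also have "\<dots> = coord (reverse y * reverse x) S"
    by (simp add: coord_mult)
  finally show "coord (reverse (x * y)) S = coord (reverse y * reverse x) S" .
qed

definition vectors :: "'a :: comm_ring_1 cga set" where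
  "vectors = range (\<lambda>v. \<Sum>i\<in>UNIV. scale (v i) (gen i))"

definition points :: "'a :: comm_ring_1 cga set" where
  "points = {a \<in> vectors. a \<noteq> 0 \<and> a * a = 0}"

text \<open>
  The value of \<open>vdot\<close> is the scalar itself, that is, the coordinate at the empty blade;
  see \<open>scalar_vdot\<close>.
\<close>

definition vdot :: "'a :: field_char_0 cga \<Rightarrow> 'a cga \<Rightarrow> 'a" where
  "vdot a b = coord (scale (1 / 2) (a * b + b * a)) {}"

definition vwedge :: "'a :: field_char_0 cga \<Rightarrow> 'a cga \<Rightarrow> 'a cga" where
  "vwedge a b = scale (1 / 2) (a * b - b * a)"

lemma scalar_vdot:
  assumes "a \<in> vectors" "b \<in> vectors"
  shows "scalar (vdot a b) = scale (1 / 2) (a * b + b * a)"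
proof -
  obtain v w where a: "a = (\<Sum>i\<in>UNIV. scale (v i) (gen i))" and b: "b = (\<Sum>i\<in>UNIV. scale (w i) (gen i))"
    using assms by (auto simp: vectors_def)
  have sc: "scale c x * scale d y = scalar (c * d) * (x * y)" for c d and x y :: "'a cga"
  proof -
    have "x * (scalar d * y) = scalar d * (x * y)"
      by (metis mult.assoc mult_scalar scalar_mult)
    then have "scale c x * scale d y = scalar c * scalar d * (x * y)"
      by (simp only: scalar_mult [symmetric] mult.assoc)
    also have "scalar c * scalar d = scalar (c * d)"
      unfolding scalar_mult by (rule cga_eqI) simp
    finally show ?thesis .
  qed
  have g: "coord (gen i * gen j + gen j * gen i :: 'a cga) S = 0" if "S \<noteq> {}" for i j S
    using that by (cases "i = j") (simp_all add: gen_mult_self gen_anticommute [of i j])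
  have "a * b + b * a = (\<Sum>i\<in>UNIV. \<Sum>j\<in>UNIV. scale (v i) (gen i) * scale (w j) (gen j))
      + (\<Sum>i\<in>UNIV. \<Sum>j\<in>UNIV. scale (w j) (gen j) * scale (v i) (gen i))"
    unfolding a b sum_product by (subst (2) sum.swap) (rule refl)
  also have "\<dots> = (\<Sum>i\<in>UNIV. \<Sum>j\<in>UNIV. scale (v i * w j) (gen i * gen j + gen j * gen i))"
    unfolding sum.distrib [symmetric]
  proof (intro sum.cong refl)
    fix i j
    show "scale (v i) (gen i) * scale (w j) (gen j) + scale (w j) (gen j) * scale (v i) (gen i) =
        scale (v i * w j) (gen i * gen j + gen j * gen i)"
      unfolding sc mult.commute [of "w j"] by (simp only: scalar_mult [symmetric] distrib_left)
  qed
  finally have "coord (a * b + b * a) S = 0" if "S \<noteq> {}" for S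
    using g [OF that] by simp
  then show ?thesis
    by (intro cga_eqI) (simp add: vdot_def)
qed


section \<open>Polynomials over the Clifford algebra\<close>

text \<open>
  Multiplication of \<open>'a poly\<close> is only available for commutative coefficients. We use
  finitely supported coefficient sequences \<^typ>\<open>nat \<Rightarrow>\<^sub>0 'a\<close> instead, whose
  convolution product makes the indeterminate commute with all coefficients. The ring of real
  polynomials is \<^typ>\<open>nat \<Rightarrow>\<^sub>0 real\<close>.
\<close>

abbreviation indet :: "nat \<Rightarrow>\<^sub>0 'a :: zero_neq_one" where
  "indet \<equiv> Poly_Mapping.single 1 1"

abbreviation const :: "'a \<Rightarrow> nat \<Rightarrow>\<^sub>0 'a :: zero" where
  "const c \<equiv> Poly_Mapping.single 0 c"

abbreviation coeff :: "(nat \<Rightarrow>\<^sub>0 'a :: zero) \<Rightarrow> nat \<Rightarrow> 'a" where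
  "coeff \<equiv> Poly_Mapping.lookup"

abbreviation map_coeffs :: "('a :: zero \<Rightarrow> 'b :: zero) \<Rightarrow> (nat \<Rightarrow>\<^sub>0 'a) \<Rightarrow> nat \<Rightarrow>\<^sub>0 'b" where
  "map_coeffs \<equiv> Poly_Mapping.map"

definition monic :: "(nat \<Rightarrow>\<^sub>0 'a :: zero_neq_one) \<Rightarrow> bool" where
  "monic p \<longleftrightarrow> (\<exists>n. coeff p n = 1 \<and> (\<forall>m>n. coeff p m = 0))"

definition coeffs_in :: "'a :: zero set \<Rightarrow> (nat \<Rightarrow>\<^sub>0 'a) set" where
  "coeffs_in A = {p. \<forall>n. coeff p n \<in> A}"

definition complexify :: "real cga \<Rightarrow> complex cga" where
  "complexify x = Multivector (\<lambda>S. complex_of_real (coord x S))"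

definition eval_at :: "(nat \<Rightarrow>\<^sub>0 complex cga) \<Rightarrow> complex \<Rightarrow> complex cga" where
  "eval_at p z = (\<Sum>n\<in>Poly_Mapping.keys p. scale (z ^ n) (coeff p n))"

definition spinor_polynomial :: "(nat \<Rightarrow>\<^sub>0 real cga) \<Rightarrow> bool" where
  "spinor_polynomial C \<longleftrightarrow> C \<in> coeffs_in cga_even \<and>
     C * map_coeffs reverse C = map_coeffs reverse C * C \<and>
     (\<exists>N :: nat \<Rightarrow>\<^sub>0 real. N \<noteq> 0 \<and> C * map_coeffs reverse C = map_coeffs scalar N)"

text \<open>
  The cofactor may have complex coefficients when \<open>h\<close> does; for real \<open>h\<close> it is
  required to be real as well.
\<close>

definition has_left_factor :: "(nat \<Rightarrow>\<^sub>0 real cga) \<Rightarrow> complex cga \<Rightarrow> bool" where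
  "has_left_factor C h \<longleftrightarrow> h \<in> cga_even \<and>
     (\<exists>Q \<in> coeffs_in cga_even. map_coeffs complexify C = (indet - const h) * Q \<and>
        (h \<in> range complexify \<longrightarrow> Q \<in> coeffs_in (range complexify)))"

end

theory Submission
  imports Defs
begin

text \<open>
  Put \<open>p = a\<^sub>1 a\<^sub>2 / (2 a\<^sub>1\<cdot>a\<^sub>2)\<close> and \<open>q = a\<^sub>2 a\<^sub>1 / (2 a\<^sub>1\<cdot>a\<^sub>2)\<close>. Since \<open>a\<^sub>1\<^sup>2 = a\<^sub>2\<^sup>2 = 0\<close>, these are
  complementary idempotents interchanged by reversion, and \<open>h = z\<^sub>1 q + z\<^sub>2 p\<close> is a spectral
  decomposition. Hence \<open>h\<^sup>n = z\<^sub>1\<^sup>n q + z\<^sub>2\<^sup>n p\<close>, and the remainder of \<open>C\<close> on left division by \<open>t - h\<close>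
  is \<open>\<Sum> h\<^sup>n c\<^sub>n = q C(z\<^sub>1) + p C(z\<^sub>2) = 0\<close>.
\<close>

section \<open>Scaling, vectors and the even subalgebra\<close>

lemma scale_mult_left: "scale c x * y = scale c (x * y)"
  by (simp only: scalar_mult [symmetric] mult.assoc)

lemma scale_mult_right: "x * scale c y = scale c (x * y)"
  by (metis mult_scalar mult.assoc scalar_mult)

lemma scale_scale: "scale c (scale d x) = scale (c * d) x"
  by (rule cga_eqI) (simp add: mult.assoc)

lemma scale_add_right: "scale c (x + y) = scale c x + scale c y"
  by (rule cga_eqI) (simp add: distrib_left)

lemma scale_zero_right: "scale c 0 = 0"
  by (rule cga_eqI) simp

lemma coord_vectors:
  assumes "a \<in> vectors" "card S \<noteq> 1"
  shows "coord a S = 0"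
proof -
  have "S \<noteq> {i}" for i using assms(2) by auto
  then show ?thesis using assms(1) by (auto simp: vectors_def gen_def)
qed

lemma reverse_vectors:
  assumes "a \<in> vectors"
  shows "reverse a = a"
proof (rule cga_eqI)
  fix S
  show "coord (reverse a) S = coord a S"
    using coord_vectors [OF assms, of S] by (cases "card S = 1") (auto simp: numeral_2_eq_2)
qed

lemma even_card_sym_diff:
  "even (card (sym_diff A B)) \<longleftrightarrow> even (card A + card B)"
  for A B :: "cga_gen set"
  by (metis card_sym_diff dvd_add_left_iff dvd_triv_left)

text \<open>A term of \<open>coord (a * b) S\<close> can be nonzero only if \<open>A\<close> and
  \<open>sym_diff A S\<close> are both singletons, and then \<open>S\<close> has even size.\<close>

lemma mult_vectors_even:
  assumes "a \<in> vectors" "b \<in> vectors"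
  shows "a * b \<in> cga_even"
proof -
  have "coord a A * coord b (sym_diff A S) = 0" if "odd (card S)" for A S
  proof -
    have "card A \<noteq> 1 \<or> card (sym_diff A S) \<noteq> 1"
      using even_card_sym_diff [of A S] that by auto
    then show ?thesis
      using coord_vectors [OF assms(1)] coord_vectors [OF assms(2)]
      by (metis mult_zero_left mult_zero_right)
  qed
  then show ?thesis
    by (simp add: cga_even_def times_cga_def mult.assoc del: mult_eq_0_iff)
qed

lemma cga_even_mult:
  assumes "x \<in> cga_even" "y \<in> cga_even"
  shows "x * y \<in> cga_even"
proof -
  have "coord x A * coord y (sym_diff A S) = 0" if "odd (card S)" for A S
  proof -
    have "odd (card A) \<or> odd (card (sym_diff A S))"
      using even_card_sym_diff [of A S] that by simp
    then show ?thesis using assms by (auto simp: cga_even_def)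
  qed
  then show ?thesis
    by (simp add: cga_even_def times_cga_def mult.assoc del: mult_eq_0_iff)
qed

lemma cga_even_add: "x \<in> cga_even \<Longrightarrow> y \<in> cga_even \<Longrightarrow> x + y \<in> cga_even"
  by (simp add: cga_even_def)

lemma cga_even_scale: "x \<in> cga_even \<Longrightarrow> scale c x \<in> cga_even"
  by (simp add: cga_even_def)

section \<open>Complexification of real multivectors\<close>

lemma coord_complexify [simp]: "coord (complexify x) S = complex_of_real (coord x S)"
  by (simp add: complexify_def)

lemma complexify_zero: "complexify 0 = 0"
  by (rule cga_eqI) simp

lemma complexify_add: "complexify (x + y) = complexify x + complexify y"
  by (rule cga_eqI) simp

lemma complexify_mult: "complexify (x * y) = complexify x * complexify y"
  by (rule cga_eqI) (simp add: coord_mult)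

lemma range_complexify_add:
  assumes "x \<in> range complexify" "y \<in> range complexify"
  shows "x + y \<in> range complexify"
proof -
  obtain v w where "x = complexify v" "y = complexify w" using assms by blast
  then show ?thesis by (simp flip: complexify_add)
qed

lemma range_complexify_mult:
  assumes "x \<in> range complexify" "y \<in> range complexify"
  shows "x * y \<in> range complexify"
proof -
  obtain v w where "x = complexify v" "y = complexify w" using assms by blast
  then show ?thesis by (simp flip: complexify_mult)
qed

section \<open>Left division of polynomials by \<open>t - h\<close>\<close>

lemma coeff_map:
  assumes "f 0 = 0"
  shows "coeff (map_coeffs f p) n = f (coeff p n)"
  using assms by (simp add: Poly_Mapping.map.rep_eq when_def)

lemma poly_mapping_sum_single: "p = (\<Sum>n\<in>Poly_Mapping.keys p. Poly_Mapping.single n (coeff p n))"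
  by (rule poly_mapping_eqI) (simp add: lookup_sum lookup_single when_def in_keys_iff)

text \<open>This is the factorisation of \<open>t^n - h^n\<close>, valid because the indeterminate
  commutes with \<open>h\<close>. The powers of \<open>h\<close> stay to the left of
  \<open>c\<close>, since \<open>h\<close> and \<open>c\<close> need not commute.\<close>

lemma single_left_division:
  fixes h c :: "'a :: ring_1"
  shows "Poly_Mapping.single n c =
    (indet - const h) * (\<Sum>i<n. Poly_Mapping.single (n - Suc i) (h ^ i * c)) + const (h ^ n * c)"
proof (induction n arbitrary: c)
  case (Suc n)
  have "(\<Sum>i<Suc n. Poly_Mapping.single (Suc n - Suc i) (h ^ i * c)) =
      Poly_Mapping.single n c + (\<Sum>i<n. Poly_Mapping.single (n - Suc i) (h ^ i * (h * c)))"
    by (subst sum.lessThan_Suc_shift) (simp add: power_Suc2 mult.assoc del: power_Suc)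
  \<comment> \<open>Splitting off one factor replaces \<open>t^(n+1) c\<close> by
    \<open>t^n (h c)\<close>, so the induction hypothesis is used at \<open>h * c\<close>.\<close>
  moreover have "(indet - const h) * Poly_Mapping.single n c =
      Poly_Mapping.single (Suc n) c - Poly_Mapping.single n (h * c)"
    by (simp add: left_diff_distrib mult_single)
  ultimately show ?case
    using Suc [of "h * c"] by (simp add: distrib_left power_Suc2 mult.assoc del: power_Suc)
qed simp

text \<open>The cofactor is built from \<open>h\<close> and the coefficients of \<open>p\<close> by
  sums and products only, so it stays over \<open>A\<close>. The remainder is \<open>p\<close> with
  \<open>h\<close> substituted from the left. Keeping \<open>A\<close> general covers real and
  complex coefficients alike.\<close>

lemma left_division:
  fixes p :: "nat \<Rightarrow>\<^sub>0 'a :: ring_1"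
  assumes zero: "0 \<in> A"
    and add: "\<And>x y. x \<in> A \<Longrightarrow> y \<in> A \<Longrightarrow> x + y \<in> A"
    and mult: "\<And>x y. x \<in> A \<Longrightarrow> y \<in> A \<Longrightarrow> x * y \<in> A"
    and h: "h \<in> A" and p: "p \<in> coeffs_in A"
  obtains Q where "Q \<in> coeffs_in A"
    and "p = (indet - const h) * Q + const (\<Sum>n\<in>Poly_Mapping.keys p. h ^ n * coeff p n)"
proof
  let ?q = "\<lambda>n. \<Sum>i<n. Poly_Mapping.single (n - Suc i) (h ^ i * coeff p n)"
  let ?Q = "\<Sum>n\<in>Poly_Mapping.keys p. ?q n"
  have sum: "sum f I \<in> A" if "\<And>i. i \<in> I \<Longrightarrow> f i \<in> A" for f :: "nat \<Rightarrow> 'a" and I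
    using that by (induction I rule: infinite_finite_induct) (simp_all add: zero add)
  have "h ^ i * coeff p n \<in> A" for i n
    by (induction i) (use p h in \<open>simp_all add: coeffs_in_def mult mult.assoc\<close>)
  then show "?Q \<in> coeffs_in A"
    by (auto simp: coeffs_in_def lookup_sum lookup_single when_def zero intro!: sum)
  have const_sum: "const (sum f I) = (\<Sum>n\<in>I. const (f n))" for f :: "nat \<Rightarrow> 'a" and I
    by (induction I rule: infinite_finite_induct) (simp_all add: single_add)
  have "p = (\<Sum>n\<in>Poly_Mapping.keys p. (indet - const h) * ?q n + const (h ^ n * coeff p n))"
    by (subst poly_mapping_sum_single) (intro sum.cong refl single_left_division)
  then show "p = (indet - const h) * ?Q + const (\<Sum>n\<in>Poly_Mapping.keys p. h ^ n * coeff p n)"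
    by (simp add: sum.distrib sum_distrib_left const_sum)
qed

lemma has_left_factorI:
  assumes C: "C \<in> coeffs_in cga_even" and h: "h \<in> cga_even"
    and root: "(\<Sum>n\<in>Poly_Mapping.keys (map_coeffs complexify C).
      h ^ n * coeff (map_coeffs complexify C) n) = 0"
  shows "has_left_factor C h"
proof -
  let ?R = "range complexify"
  \<comment> \<open>For real \<open>h\<close> the division takes place over the real even elements,
    otherwise over all even ones; this secures the reality clause of
    \<open>has_left_factor\<close>.\<close>
  define A where "A = (if h \<in> ?R then cga_even \<inter> ?R else cga_even)"
  let ?P = "map_coeffs complexify C"
  have R: "0 \<in> ?R" by (metis complexify_zero rangeI)
  have A: "0 \<in> A" "h \<in> A" "?P \<in> coeffs_in A"
    using R C h by (simp_all add: A_def coeffs_in_def coeff_map complexify_zero cga_even_def)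
  have closed: "x + y \<in> A" "x * y \<in> A" if "x \<in> A" "y \<in> A" for x y
    using that unfolding A_def
    by (simp_all add: cga_even_add cga_even_mult range_complexify_add range_complexify_mult
        split: if_splits)
  obtain Q where "Q \<in> coeffs_in A" "?P = (indet - const h) * Q"
  proof (rule left_division [OF A(1) closed A(2,3)])
    fix Q
    assume "Q \<in> coeffs_in A"
      "?P = (indet - const h) * Q + const (\<Sum>n\<in>Poly_Mapping.keys ?P. h ^ n * coeff ?P n)"
    then show thesis using that [of Q] unfolding root by simp
  qed
  then show ?thesis
    unfolding has_left_factor_def using h by (auto simp: A_def coeffs_in_def split: if_splits)
qed

section \<open>Powers and substitution for a spectral decomposition\<close>

lemma power_spectral_decomposition:
  assumes "p + q = 1" "p * p = p" "q * q = q" "p * q = 0" "q * p = 0"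
  shows "(scale u p + scale v q) ^ n = scale (u ^ n) p + scale (v ^ n) q"
proof (induction n)
  case 0
  have "scale 1 x = x" for x :: "'a cga" by (rule cga_eqI) simp
  then show ?case using assms(1) by simp
next
  case (Suc n)
  then show ?case
    by (simp add: distrib_left distrib_right scale_mult_left scale_mult_right scale_scale
        scale_zero_right mult.commute assms)
qed

text \<open>Scalars are central, so left substitution splits, power by power, into ordinary
  evaluations at the eigenvalues \<open>u\<close> and \<open>v\<close>.\<close>

lemma eval_at_spectral_decomposition:
  assumes "p + q = 1" "p * p = p" "q * q = q" "p * q = 0" "q * p = 0"
  shows "(\<Sum>n\<in>Poly_Mapping.keys P. (scale u p + scale v q) ^ n * coeff P n) =
    p * eval_at P u + q * eval_at P v"
  unfolding power_spectral_decomposition [OF assms]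
  by (simp add: eval_at_def distrib_right sum.distrib scale_mult_left scale_mult_right
      sum_distrib_left)

theorem theorem1:
  fixes C :: "nat \<Rightarrow>\<^sub>0 real cga"
    and M N :: "nat \<Rightarrow>\<^sub>0 real"
    and z1 z2 :: complex
    and a1 a2 h :: "complex cga"
  assumes "spinor_polynomial C"
    and "monic C"
    and "map_coeffs complex_of_real M = (indet - const z1) * (indet - const z2)"
    and "C * map_coeffs reverse C = map_coeffs scalar N"
    and "M dvd N"
    and "a1 \<in> points"
    and "a2 \<in> points"
    and "vdot a1 a2 \<noteq> 0"
    and "a1 * eval_at (map_coeffs complexify C) z1 = 0"
    and "a2 * eval_at (map_coeffs complexify C) z2 = 0"
    and "h = scalar z1 - scale ((z1 - z2) / (2 * vdot a1 a2)) (a1 * a2)"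
  shows "h = scalar ((z1 + z2) / 2) - scale ((z1 - z2) / (2 * vdot a1 a2)) (vwedge a1 a2) \<and>
    has_left_factor C h \<and>
    (indet - const h) * (indet - const (reverse h)) =
      map_coeffs (\<lambda>c. scalar (complex_of_real c)) M"
proof -
  \<comment> \<open>The factor \<open>l\<close> normalises \<open>a1 * a2 + a2 * a1\<close>, which
    is twice the scalar \<open>vdot a1 a2\<close>, to 1.\<close>
  define l where "l = 1 / (2 * vdot a1 a2)"
  define p where "p = scale l (a1 * a2)"
  define q where "q = scale l (a2 * a1)"
  have vec: "a1 \<in> vectors" "a2 \<in> vectors" and sq: "a1 * a1 = 0" "a2 * a2 = 0"
    using assms(6,7) by (auto simp: points_def)
  have dot: "scalar (vdot a1 a2) = scale (1 / 2) (a1 * a2 + a2 * a1)"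
    using scalar_vdot [OF vec] .
  have pq: "p + q = 1"
  proof -
    have "scale (2 * l) (scalar (vdot a1 a2)) = p + q"
      unfolding dot p_def q_def by (simp add: scale_scale scale_add_right)
    moreover have "scale (2 * l) (scalar (vdot a1 a2)) = 1"
      by (rule cga_eqI) (simp add: l_def assms(8))
    ultimately show ?thesis by simp
  qed
  have "a1 * a2 * (a2 * a1) = 0" "a2 * a1 * (a1 * a2) = 0"
    by (metis sq mult.assoc mult_zero_left mult_zero_right)+
  then have "p * q = 0" "q * p = 0"
    by (simp_all add: p_def q_def scale_mult_left scale_mult_right scale_zero_right)
  \<comment> \<open>Multiplying \<open>p + q = 1\<close> by \<open>p\<close> or by \<open>q\<close>
    kills the mixed product.\<close>
  moreover from this have "p * p = p" "q * q = q"
    using pq by (metis add.right_neutral distrib_left mult.right_neutral,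
        metis add.left_neutral distrib_left mult.right_neutral)
  \<comment> \<open>Here \<open>q\<close> comes first because it belongs to the eigenvalue
    \<open>z1\<close>.\<close>
  ultimately have idem: "q + p = 1" "q * q = q" "p * p = p" "q * p = 0" "p * q = 0"
    using pq by (simp_all add: add.commute)
  have h0: "h = scalar z1 - scale (z1 - z2) p"
    unfolding assms(11) p_def scale_scale l_def by simp
  \<comment> \<open>Coordinatewise, a scalar \<open>c\<close> can now be written as
    \<open>c (p + q)\<close>, which reduces identities for \<open>h\<close> to commutative
    algebra.\<close>
  have pqc: "coord p S + coord q S = (if S = {} then 1 else 0)" for S
    using arg_cong [OF pq, of "\<lambda>x. coord x S"] by simp
  have hpq: "h = scale z1 q + scale z2 p"
  proof (rule cga_eqI)
    fix S
    have "coord (scalar z1) S = z1 * (coord p S + coord q S)"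
      unfolding pqc by simp
    then show "coord h S = coord (scale z1 q + scale z2 p) S"
      unfolding h0 by (simp add: algebra_simps)
  qed
  \<comment> \<open>Reversion fixes vectors and so exchanges \<open>p\<close> and \<open>q\<close>;
    thus \<open>h\<close> and \<open>reverse h\<close> share eigenspaces with the eigenvalues
    swapped.\<close>
  have rev_h: "reverse h = scale z1 p + scale z2 q"
    by (simp add: hpq p_def q_def reverse_add reverse_scale reverse_mult reverse_vectors vec)
  have wedge: "h = scalar ((z1 + z2) / 2) - scale ((z1 - z2) / (2 * vdot a1 a2)) (vwedge a1 a2)"
  proof (rule cga_eqI)
    fix S
    have l: "(z1 - z2) / (2 * vdot a1 a2) = (z1 - z2) * l"
      by (simp add: l_def)
    have w: "scale ((z1 - z2) / (2 * vdot a1 a2)) (vwedge a1 a2) =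
        scale ((z1 - z2) / 2) (p - q)"
      unfolding l by (rule cga_eqI) (simp add: vwedge_def p_def q_def algebra_simps)
    have "coord (scalar ((z1 + z2) / 2)) S = (z1 + z2) / 2 * (coord p S + coord q S)"
      unfolding pqc by simp
    then show "coord h S = coord (scalar ((z1 + z2) / 2) -
        scale ((z1 - z2) / (2 * vdot a1 a2)) (vwedge a1 a2)) S"
      unfolding w hpq by (simp add: field_simps)
  qed
  have "h \<in> cga_even"
    unfolding hpq p_def q_def
    by (intro cga_even_add cga_even_scale mult_vectors_even vec)
  moreover have "C \<in> coeffs_in cga_even"
    using assms(1) by (simp add: spinor_polynomial_def)
  \<comment> \<open>The rightmost factor of \<open>q\<close> is \<open>a1\<close> and that of
    \<open>p\<close> is \<open>a2\<close>, so the annihilator hypotheses apply directly.\<close>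
  moreover have "q * eval_at (map_coeffs complexify C) z1 = 0"
    "p * eval_at (map_coeffs complexify C) z2 = 0"
    by (simp_all add: p_def q_def scale_mult_left mult.assoc assms(9,10) scale_zero_right)
  then have "(\<Sum>n\<in>Poly_Mapping.keys (map_coeffs complexify C).
      h ^ n * coeff (map_coeffs complexify C) n) = 0"
    unfolding hpq eval_at_spectral_decomposition [OF idem] by simp
  ultimately have factor: "has_left_factor C h"
    by (intro has_left_factorI)
  have sum: "h + reverse h = scalar (z1 + z2)"
  proof (rule cga_eqI)
    fix S
    have "coord (scalar (z1 + z2)) S = (z1 + z2) * (coord p S + coord q S)"
      unfolding pqc by simp
    then show "coord (h + reverse h) S = coord (scalar (z1 + z2)) S"
      unfolding rev_h unfolding hpq by (simp add: algebra_simps)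
  qed
  have "h * reverse h = scale (z1 * z2) (p + q)"
    unfolding rev_h unfolding hpq
    by (simp add: distrib_left distrib_right scale_mult_left scale_mult_right scale_scale
        scale_zero_right scale_add_right idem mult.commute add.commute)
  then have prod: "h * reverse h = scalar (z1 * z2)"
    unfolding pq by (simp add: scalar_def)
  \<comment> \<open>Only the sum and product of \<open>x\<close> and \<open>y\<close> enter, so the
    pairs \<open>h\<close>, \<open>reverse h\<close> and \<open>z1\<close>, \<open>z2\<close> give
    the same polynomial up to the embedding \<open>scalar\<close>.\<close>
  have expand: "(indet - const x) * (indet - const y) =
      Poly_Mapping.single 2 1 - Poly_Mapping.single 1 (x + y) + const (x * y)"
    for x y :: "'b :: ring_1"
    by (simp add: left_diff_distrib right_diff_distrib mult_single single_add numeral_2_eq_2)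
  have "(indet - const h) * (indet - const (reverse h)) =
      map_coeffs (\<lambda>c. scalar (complex_of_real c)) M"
  proof (rule poly_mapping_eqI)
    fix n
    have scalar_0: "scalar 0 = (0 :: complex cga)" and scalar_1: "scalar 1 = (1 :: complex cga)"
      by (auto intro!: cga_eqI)
    have scalar_add: "scalar (x + y) = scalar x + scalar y"
      and scalar_diff: "scalar (x - y) = scalar x - scalar y" for x y :: complex
      by (auto intro!: cga_eqI)
    have "complex_of_real (coeff M n) = coeff ((indet - const z1) * (indet - const z2)) n"
      unfolding assms(3) [symmetric] by (simp add: coeff_map)
    then show "coeff ((indet - const h) * (indet - const (reverse h))) n =
        coeff (map_coeffs (\<lambda>c. scalar (complex_of_real c)) M) n"
      unfolding expand sum prod
      by (simp add: coeff_map lookup_add lookup_minus lookup_single when_def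
          scalar_0 scalar_1 scalar_add scalar_diff)
  qed
  with wedge factor show ?thesis by blast
qed

end
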